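(* Let $q$ be a prime power, $n$ a positive integer, and $k$ an integer with $0\le k\le n$. Then the function $f:\mathbb F_{q^n}\to\mathbb F_{q^n}$, $f(x)=x^{q^k-1}$, is $k$th order sum-free on $\mathbb F_{q^n}$.
   Context: A function $f:\mathbb F_{q^n}\to\mathbb F_{q^n}$ is called $k$th order sum-free if for every $k$-dimensional $\mathbb F_q$-affine subspace $A$ of $\mathbb F_{q^n}$ (i.e. a coset of a $k$-dimensional $\mathbb F_q$-linear subspace) one has $\sum_{x\in A}f(x)\neq 0$. For $k=0$, the function $x^{q^0-1}=x^0$ is the constant function $1$. *)

theory Defs
  imports "HOL-Algebra.Algebra" "HOL-Number_Theory.Prime_Powers"
begin

(* The locale "subalgebra K V R" of HOL-Algebra asserts closure under addition and under
   multiplication by scalars from K only, so it says that V is a K-linear subspace of R. *)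
definition linear_subspace :: "('a, 'b) ring_scheme \<Rightarrow> 'a set \<Rightarrow> nat \<Rightarrow> 'a set \<Rightarrow> bool"
  where "linear_subspace R K k V \<longleftrightarrow> subalgebra K V R \<and> ring.dimension R k K V"

definition affine_subspace :: "('a, 'b) ring_scheme \<Rightarrow> 'a set \<Rightarrow> nat \<Rightarrow> 'a set \<Rightarrow> bool"
  where "affine_subspace R K k A \<longleftrightarrow>
    (\<exists>V a. linear_subspace R K k V \<and> a \<in> carrier R \<and> A = V +>\<^bsub>R\<^esub> a)"

definition sum_free_of_order ::
    "('a, 'b) ring_scheme \<Rightarrow> 'a set \<Rightarrow> nat \<Rightarrow> ('a \<Rightarrow> 'a) \<Rightarrow> bool"
  where "sum_free_of_order R K k f \<longleftrightarrow>
    f \<in> carrier R \<rightarrow> carrier R \<and>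
    (\<forall>A. affine_subspace R K k A \<longrightarrow> (\<Oplus>\<^bsub>R\<^esub>x\<in>A. f x) \<noteq> \<zero>\<^bsub>R\<^esub>)"

end

theory Submission
  imports Defs
begin

text \<open>
  The idea is Lagrange interpolation. For a set \<open>A\<close> of \<open>N\<close> points of a field, the divided difference
  \<open>\<Sum>x\<in>A. f x / (\<Prod>y\<in>A-{x}. x - y)\<close> is the coefficient of \<open>X^(N-1)\<close> in the polynomial of degree below
  \<open>N\<close> that interpolates \<open>f\<close> on \<open>A\<close>; it equals \<open>1\<close> for \<open>f x = x^(N-1)\<close>. If \<open>A\<close> is a coset of a finite
  additive subgroup \<open>V\<close>, then all denominators are equal to the product of the nonzero
  elements of \<open>V\<close>, so the sum of \<open>x^(N-1)\<close> over \<open>A\<close> equals that product. A \<open>k\<close>-dimensional affine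
  subspace has \<open>N = q^k\<close> points.
\<close>

section \<open>Size of a finite-dimensional space over a finite subfield\<close>

text \<open>Coordinates with respect to a basis \<open>Us\<close> are unique by independence, so
  \<open>combine\<close> is a bijection from the coefficient lists of length \<open>n\<close> over
  \<open>K\<close> onto \<open>E\<close>.\<close>

lemma (in ring) card_eq_of_dimension:
  assumes K: "subfield K R" "finite K" and E: "dimension n K E"
  shows "card E = card K ^ n"
proof -
  obtain Us where Us: "independent K Us" "length Us = n" "Span K Us = E"
    using exists_base[OF K(1) E] by blast
  let ?L = "{Ks. set Ks \<subseteq> K \<and> length Ks = n}"
  have "bij_betw (\<lambda>Ks. combine Ks Us) ?L E"
  proof (rule bij_betwI')
    fix Ks Ls assume *: "Ks \<in> ?L" "Ls \<in> ?L"
    then have "combine Ks Us \<in> Span K Us"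
      using Span_eq_combine_set[OF K(1) independent_in_carrier[OF Us(1)]] by auto
    with * show "combine Ks Us = combine Ls Us \<longleftrightarrow> Ks = Ls"
      using unique_decomposition[OF K(1) Us(1), of "combine Ks Us"] Us(2) by auto
  next
    fix Ks assume "Ks \<in> ?L"
    then show "combine Ks Us \<in> E"
      using Span_eq_combine_set[OF K(1) independent_in_carrier[OF Us(1)]] Us(3) by auto
  next
    fix a assume "a \<in> E"
    then show "\<exists>Ks \<in> ?L. a = combine Ks Us"
      using unique_decomposition[OF K(1) Us(1), of a] Us(2,3) by auto
  qed
  then have "card ?L = card E"
    by (rule bij_betw_same_card)
  with card_lists_length_eq[OF K(2)] show ?thesis by simp
qed

section \<open>Divided differences over a field\<close>

context field
begin

definition divided_difference :: "'a set \<Rightarrow> ('a \<Rightarrow> 'a) \<Rightarrow> 'a"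
  where "divided_difference A f = (\<Oplus>x\<in>A. f x \<otimes> inv (\<Otimes>y\<in>A - {x}. x \<ominus> y))"

lemma finprod_nonzero:
  assumes "finite A" "f \<in> A \<rightarrow> carrier R - {\<zero>}"
  shows "finprod R f A \<in> carrier R - {\<zero>}"
  using assms
proof (induction A rule: finite_induct)
  case empty
  then show ?case by simp
next
  case (insert a A)
  then have "f \<in> A \<rightarrow> carrier R" "f a \<in> carrier R" "f a \<noteq> \<zero>" "f \<in> A \<rightarrow> carrier R - {\<zero>}"
    by auto
  then show ?case
    using insert by (simp add: integral_iff)
qed

text \<open>Cancels one linear factor against the denominator in
  \<open>divided_difference_linear_factor\<close>.\<close>

lemma inv_mult_nonzero:
  assumes "a \<in> carrier R - {\<zero>}" "b \<in> carrier R - {\<zero>}"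
  shows "a \<otimes> inv (a \<otimes> b) = inv b"
proof -
  have u: "a \<in> Units R" "b \<in> Units R"
    using assms field_Units by auto
  then have "b \<otimes> (a \<otimes> inv (a \<otimes> b)) = (a \<otimes> b) \<otimes> inv (a \<otimes> b)"
    using assms u by (metis DiffE Units_inv_closed Units_m_closed m_assoc m_comm)
  also have "\<dots> = \<one>"
    using u by (intro Units_r_inv) simp
  finally show ?thesis
    using u by (metis Units_closed Units_inv_closed Units_m_closed comm_inv_char m_closed)
qed

text \<open>Makes the denominators of \<open>divided_difference\<close> invertible.\<close>

lemma prod_minus_nonzero:
  assumes "finite A" "A \<subseteq> carrier R" "x \<in> A"
  shows "(\<Otimes>y\<in>A - {x}. x \<ominus> y) \<in> carrier R - {\<zero>}"
proof (rule finprod_nonzero)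
  show "(\<lambda>y. x \<ominus> y) \<in> A - {x} \<rightarrow> carrier R - {\<zero>}"
  proof
    fix y assume "y \<in> A - {x}"
    then have "x \<in> carrier R" "y \<in> carrier R" "x \<noteq> y"
      using assms by auto
    then show "x \<ominus> y \<in> carrier R - {\<zero>}" by simp
  qed
qed (use assms in simp)

lemma inv_prod_minus_closed [simp]:
  assumes "finite A" "A \<subseteq> carrier R" "x \<in> A"
  shows "inv (\<Otimes>y\<in>A - {x}. x \<ominus> y) \<in> carrier R"
  using prod_minus_nonzero[OF assms] field_Units by (simp add: Units_inv_closed)

lemma divided_difference_closed:
  assumes "finite A" "A \<subseteq> carrier R" "f \<in> A \<rightarrow> carrier R"
  shows "divided_difference A f \<in> carrier R"
  unfolding divided_difference_def 
proof (rule finsum_closed, rule Pi_I)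
  fix x assume "x \<in> A"
  with assms have "f x \<in> carrier R" by auto
  then show "f x \<otimes> inv (\<Otimes>y\<in>A - {x}. x \<ominus> y) \<in> carrier R"
    using assms(1,2) \<open>x \<in> A\<close> by simp
qed

lemma divided_difference_cong:
  assumes "finite A" "A \<subseteq> carrier R" "g \<in> A \<rightarrow> carrier R" "\<And>x. x \<in> A \<Longrightarrow> f x = g x"
  shows "divided_difference A f = divided_difference A g"
  unfolding divided_difference_def 
proof (rule add.finprod_cong')
  show "(\<lambda>x. g x \<otimes> inv (\<Otimes>y\<in>A - {x}. x \<ominus> y)) \<in> A \<rightarrow> carrier R"
  proof
    fix x assume "x \<in> A"
    with assms(3) have "g x \<in> carrier R" by auto
    then show "g x \<otimes> inv (\<Otimes>y\<in>A - {x}. x \<ominus> y) \<in> carrier R"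
      using assms(1,2) \<open>x \<in> A\<close> by simp
  qed
qed (use assms(4) in simp_all)

lemma divided_difference_add:
  assumes "finite A" "A \<subseteq> carrier R" "f \<in> A \<rightarrow> carrier R" "g \<in> A \<rightarrow> carrier R"
  shows "divided_difference A (\<lambda>x. f x \<oplus> g x) = divided_difference A f \<oplus> divided_difference A g"
proof -
  let ?w = "\<lambda>x. inv (\<Otimes>y\<in>A - {x}. x \<ominus> y)"
  have "divided_difference A (\<lambda>x. f x \<oplus> g x) = (\<Oplus>x\<in>A. f x \<otimes> ?w x \<oplus> g x \<otimes> ?w x)"
    unfolding divided_difference_def
  proof (rule add.finprod_cong')
    fix x assume "x \<in> A"
    then have "x \<in> carrier R" "f x \<in> carrier R" "g x \<in> carrier R"
      using assms by auto
    then show "(f x \<oplus> g x) \<otimes> ?w x = f x \<otimes> ?w x \<oplus> g x \<otimes> ?w x"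
      using assms \<open>x \<in> A\<close> by (simp add: l_distr)
  qed (use assms in \<open>auto intro!: a_closed m_closed inv_prod_minus_closed\<close>)
  also have "\<dots> = divided_difference A f \<oplus> divided_difference A g"
    unfolding divided_difference_def using assms by (intro finsum_addf) auto
  finally show ?thesis .
qed

lemma divided_difference_smult:
  assumes "finite A" "A \<subseteq> carrier R" "c \<in> carrier R" "f \<in> A \<rightarrow> carrier R"
  shows "divided_difference A (\<lambda>x. c \<otimes> f x) = c \<otimes> divided_difference A f"
proof -
  let ?w = "\<lambda>x. inv (\<Otimes>y\<in>A - {x}. x \<ominus> y)"
  have "c \<otimes> divided_difference A f = (\<Oplus>x\<in>A. c \<otimes> (f x \<otimes> ?w x))"
    unfolding divided_difference_def using assms by (intro finsum_rdistr) auto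
  also have "\<dots> = divided_difference A (\<lambda>x. c \<otimes> f x)"
    unfolding divided_difference_def
  proof (rule add.finprod_cong')
    fix x assume "x \<in> A"
    then have "x \<in> carrier R" "f x \<in> carrier R"
      using assms by auto
    then show "c \<otimes> (f x \<otimes> ?w x) = c \<otimes> f x \<otimes> ?w x"
      using assms \<open>x \<in> A\<close> by (simp add: m_assoc)
  qed (use assms in \<open>auto intro!: m_closed inv_prod_minus_closed\<close>)
  finally show ?thesis by simp
qed

text \<open>The term at \<open>a\<close> vanishes. At every other node \<open>x\<close> the factor
  \<open>x \<ominus> a\<close> cancels the same factor of the denominator, and what remains is the
  denominator for the nodes \<open>A - {a}\<close>. This is the recursion behind the two evaluations
  below.\<close>

lemma divided_difference_linear_factor:
  assumes "finite A" "A \<subseteq> carrier R" "a \<in> A" "g \<in> A \<rightarrow> carrier R"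
  shows "divided_difference A (\<lambda>x. (x \<ominus> a) \<otimes> g x) = divided_difference (A - {a}) g"
proof -
  let ?w = "\<lambda>B x. inv (\<Otimes>y\<in>B - {x}. x \<ominus> y)"
  let ?f = "\<lambda>x. (x \<ominus> a) \<otimes> g x \<otimes> ?w A x"
  have a: "a \<in> carrier R" "g a \<in> carrier R"
    using assms by auto
  have f: "?f \<in> A \<rightarrow> carrier R"
  proof
    fix x assume "x \<in> A"
    then have "x \<in> carrier R" "g x \<in> carrier R"
      using assms by auto
    then show "?f x \<in> carrier R"
      using assms \<open>x \<in> A\<close> a by simp
  qed
  have "divided_difference A (\<lambda>x. (x \<ominus> a) \<otimes> g x) = (\<Oplus>x\<in>insert a (A - {a}). ?f x)"
    unfolding divided_difference_def using assms(3) by (simp add: insert_absorb)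
  also have "\<dots> = ?f a \<oplus> (\<Oplus>x\<in>A - {a}. ?f x)"
    using assms(1,3) f by (intro add.finprod_insert) auto
  also have "\<dots> = (\<Oplus>x\<in>A - {a}. ?f x)"
  proof -
    have "a \<ominus> a = \<zero>"
      using a by simp
    then have "?f a = \<zero> \<otimes> g a \<otimes> ?w A a"
      by (simp only:)
    then have "?f a = \<zero>"
      using assms a by simp
    moreover have "(\<Oplus>x\<in>A - {a}. ?f x) \<in> carrier R"
      using f by (intro finsum_closed) auto
    ultimately show ?thesis by simp
  qed
  also have "\<dots> = (\<Oplus>x\<in>A - {a}. g x \<otimes> ?w (A - {a}) x)"
  proof (rule add.finprod_cong')
    show "(\<lambda>x. g x \<otimes> ?w (A - {a}) x) \<in> A - {a} \<rightarrow> carrier R"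
      using assms by (intro Pi_I m_closed inv_prod_minus_closed) auto
  next
    fix x assume x: "x \<in> A - {a}"
    then have xc: "x \<in> carrier R" "g x \<in> carrier R" "x \<ominus> a \<in> carrier R - {\<zero>}"
      using assms a by auto
    have sub: "A - {a} \<subseteq> carrier R" using assms by auto
    have P: "(\<Otimes>y\<in>A - {a} - {x}. x \<ominus> y) \<in> carrier R - {\<zero>}"
      using assms x sub by (intro prod_minus_nonzero) auto
    \<comment> \<open>The split isolates the factor \<open>x \<ominus> a\<close> of the
      denominator.\<close>
    have "A - {x} = insert a (A - {a} - {x})"
      using x assms by auto
    then have "(\<Otimes>y\<in>A - {x}. x \<ominus> y) = (x \<ominus> a) \<otimes> (\<Otimes>y\<in>A - {a} - {x}. x \<ominus> y)"
      using assms xc a by (simp only:, intro finprod_insert) auto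
    then have "(x \<ominus> a) \<otimes> ?w A x = ?w (A - {a}) x"
      using inv_mult_nonzero[OF xc(3) P] by simp
    then show "?f x = g x \<otimes> ?w (A - {a}) x"
      using assms x xc inv_prod_minus_closed[of A x] by (metis DiffE m_comm m_assoc)
  qed simp
  finally show ?thesis
    unfolding divided_difference_def .
qed

text \<open>For distinct nodes \<open>a\<close> and \<open>b\<close>, write
  \<open>x \<ominus> a\<close> as \<open>(b \<ominus> a) \<oplus> (x \<ominus> b)\<close>. By the
  linear factor rule, \<open>x \<ominus> a\<close> and \<open>x \<ominus> b\<close> yield the
  divided differences of \<open>\<one>\<close> over \<open>A - {a}\<close> and
  \<open>A - {b}\<close>. These agree by induction, so \<open>b \<ominus> a\<close> times the
  divided difference over \<open>A\<close> is zero.\<close>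

lemma divided_difference_one:
  assumes "finite A" "A \<subseteq> carrier R" "A \<noteq> {}"
  shows "divided_difference A (\<lambda>_. \<one>) = (if card A = 1 then \<one> else \<zero>)"
  using assms
proof (induction "card A" arbitrary: A rule: less_induct)
  case less
  show ?case
  proof (cases "card A = 1")
    case True
    then obtain a where "A = {a}" by (auto simp: card_1_singleton_iff)
    then show ?thesis
      using less.prems by (simp add: divided_difference_def)
  next
    case False
    then obtain a b where ab: "a \<in> A" "b \<in> A" "a \<noteq> b"
      using less.prems by (metis card_1_singleton_iff all_not_in_conv is_singletonI' is_singleton_def One_nat_def)
    then have c: "a \<in> carrier R" "b \<in> carrier R" using less.prems by auto
    let ?D = "divided_difference A (\<lambda>_. \<one>)"
    have D: "?D \<in> carrier R"
      using less.prems by (intro divided_difference_closed) auto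
    \<comment> \<open>The value does not depend on the removed node \<open>u\<close>, which is what
      lets the two smaller divided differences cancel.\<close>
    have eq: "divided_difference (A - {u}) (\<lambda>_. \<one>) = (if card A = 2 then \<one> else \<zero>)"
      if "u \<in> A" for u
    proof -
      have "card A > 0"
        using less.prems by (simp add: card_gt_0_iff)
      then have "card (A - {u}) < card A" and card: "card (A - {u}) = card A - 1"
        using less.prems that by auto
      moreover have "A - {u} \<noteq> {}" "finite (A - {u})" "A - {u} \<subseteq> carrier R"
        using less.prems ab by auto
      ultimately have "divided_difference (A - {u}) (\<lambda>_. \<one>) = (if card A - 1 = 1 then \<one> else \<zero>)"
        using less.hyps[of "A - {u}"] by simp
      moreover have "card A - 1 = 1 \<longleftrightarrow> card A = 2"
        by auto
      ultimately show ?thesis by simp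
    qed
    have "(b \<ominus> a) \<otimes> ?D \<oplus> divided_difference A (\<lambda>x. (x \<ominus> b) \<otimes> \<one>)
        = divided_difference A (\<lambda>x. (b \<ominus> a) \<otimes> \<one>) \<oplus> divided_difference A (\<lambda>x. (x \<ominus> b) \<otimes> \<one>)"
      using less.prems c by (subst divided_difference_smult) auto
    also have "\<dots> = divided_difference A (\<lambda>x. (b \<ominus> a) \<otimes> \<one> \<oplus> (x \<ominus> b) \<otimes> \<one>)"
      using less.prems c by (intro divided_difference_add[symmetric]) auto
    also have "\<dots> = divided_difference A (\<lambda>x. (x \<ominus> a) \<otimes> \<one>)"
    proof (rule divided_difference_cong)
      fix x assume "x \<in> A"
      then have "x \<in> carrier R" using less.prems by auto
      with c show "(b \<ominus> a) \<otimes> \<one> \<oplus> (x \<ominus> b) \<otimes> \<one> = (x \<ominus> a) \<otimes> \<one>" by algebra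
    qed (use less.prems c in auto)
    \<comment> \<open>The factors \<open>\<one>\<close> are kept, hence \<open>del: r_one\<close>,
      so that the linear factor rule matches with a constant function as \<open>g\<close>.\<close>
    finally have "(b \<ominus> a) \<otimes> ?D \<oplus> (if card A = 2 then \<one> else \<zero>) = (if card A = 2 then \<one> else \<zero>)"
      using less.prems ab by (simp add: divided_difference_linear_factor eq del: r_one)
    then have "(b \<ominus> a) \<otimes> ?D = \<zero>"
      using D c by (auto split: if_splits)
    then show ?thesis
      using D c ab False by (auto simp: integral_iff)
  qed
qed

text \<open>Induction on \<open>j\<close> by splitting \<open>x [^] Suc j\<close> into
  \<open>(x \<ominus> a) \<otimes> x [^] j\<close> and \<open>a \<otimes> x [^] j\<close>. The first
  summand lowers exponent and number of nodes together; \<open>A\<close> is arbitrary because the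
  node \<open>a\<close> gets removed.\<close>

lemma divided_difference_pow:
  assumes "finite A" "A \<subseteq> carrier R" "j < card A"
  shows "divided_difference A (\<lambda>x. x [^] j) = (if Suc j = card A then \<one> else \<zero>)"
  using assms
proof (induction j arbitrary: A)
  case 0
  then have "A \<noteq> {}" by auto
  with 0 show ?case
    by (simp add: divided_difference_one)
next
  case (Suc j)
  then obtain a where a: "a \<in> A" by fastforce
  then have c: "a \<in> carrier R" using Suc.prems by auto
  have "divided_difference A (\<lambda>x. x [^] Suc j)
      = divided_difference A (\<lambda>x. (x \<ominus> a) \<otimes> x [^] j \<oplus> a \<otimes> x [^] j)"
  proof (rule divided_difference_cong)
    fix x assume "x \<in> A"
    then have x: "x \<in> carrier R" using Suc.prems by auto
    then have "x [^] j \<in> carrier R" by simp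
    with x c have "x [^] j \<otimes> x = (x \<ominus> a) \<otimes> x [^] j \<oplus> a \<otimes> x [^] j" by algebra
    then show "x [^] Suc j = (x \<ominus> a) \<otimes> x [^] j \<oplus> a \<otimes> x [^] j" by simp
  qed (use Suc.prems c in auto)
  also have "\<dots> = divided_difference A (\<lambda>x. (x \<ominus> a) \<otimes> x [^] j)
      \<oplus> divided_difference A (\<lambda>x. a \<otimes> x [^] j)"
    using Suc.prems c by (intro divided_difference_add) auto
  also have "divided_difference A (\<lambda>x. (x \<ominus> a) \<otimes> x [^] j) = divided_difference (A - {a}) (\<lambda>x. x [^] j)"
    using Suc.prems a by (intro divided_difference_linear_factor) auto
  also have "\<dots> = (if Suc (Suc j) = card A then \<one> else \<zero>)"
  proof -
    have "card A = Suc (card (A - {a}))"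
      using Suc.prems(1) a by (intro card.remove)
    moreover have "finite (A - {a})" "A - {a} \<subseteq> carrier R"
      using Suc.prems by auto
    ultimately show ?thesis
      using Suc.IH[of "A - {a}"] Suc.prems(3) by simp
  qed
  also have "divided_difference A (\<lambda>x. a \<otimes> x [^] j) = a \<otimes> divided_difference A (\<lambda>x. x [^] j)"
    using Suc.prems c by (intro divided_difference_smult) auto
  \<comment> \<open>Since \<open>Suc j < card A\<close>, the exponent \<open>j\<close> lies below
    the top one for the full set \<open>A\<close>.\<close>
  also have "divided_difference A (\<lambda>x. x [^] j) = \<zero>"
    using Suc.IH[of A] Suc.prems by simp
  finally show ?case
    using c by simp
qed

section \<open>Power sums over cosets of additive subgroups\<close>

lemma sum_pow_coset:
  assumes V: "subgroup V (add_monoid R)" "finite V" and a: "a \<in> carrier R"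
  shows "(\<Oplus>x\<in>V +> a. x [^] (card V - 1)) = (\<Otimes>v\<in>V - {\<zero>}. v)"
proof -
  let ?A = "V +> a" and ?P = "\<Otimes>v\<in>V - {\<zero>}. v"
  have Vc: "V \<subseteq> carrier R" "\<zero> \<in> V"
    and Vadd: "\<And>u v. u \<in> V \<Longrightarrow> v \<in> V \<Longrightarrow> u \<ominus> v \<in> V"
    using subgroup.subset[OF V(1)] subgroup.one_closed[OF V(1)]
      add.subgroupE(3,4)[OF V(1)] by (auto simp: a_minus_def)
  have A: "?A = (\<lambda>v. v \<oplus> a) ` V"
    by (auto simp: a_r_coset_def')
  have Ac: "?A \<subseteq> carrier R" "finite ?A"
    unfolding A using Vc V(2) a by auto
  have "inj_on (\<lambda>v. v \<oplus> a) V"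
    using Vc a by (auto simp: inj_on_def subset_iff)
  then have card: "card ?A = card V"
    unfolding A by (rule card_image)
  have P: "?P \<in> carrier R - {\<zero>}"
    using Vc V(2) by (intro finprod_nonzero) auto
  \<comment> \<open>Two elements of the coset differ by an element of \<open>V\<close>, so
    \<open>y \<mapsto> x \<ominus> y\<close> maps the other points of the coset bijectively onto the
    nonzero elements of \<open>V\<close>, whatever \<open>x\<close> is.\<close>
  have denom: "(\<Otimes>y\<in>?A - {x}. x \<ominus> y) = ?P" if x: "x \<in> ?A" for x
  proof -
    have xc: "x \<in> carrier R" using x Ac by auto
    have inj: "inj_on (\<lambda>y. x \<ominus> y) (?A - {x})"
    proof (rule inj_onI)
      fix y z assume "y \<in> ?A - {x}" "z \<in> ?A - {x}" and e: "x \<ominus> y = x \<ominus> z"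
      then have yz: "y \<in> carrier R" "z \<in> carrier R" using Ac by auto
      \<comment> \<open>The map \<open>y \<mapsto> x \<ominus> y\<close> is its own inverse; this
        also supplies the preimage \<open>x \<ominus> w\<close> of \<open>w\<close> below.\<close>
      then have "y = x \<ominus> (x \<ominus> y)" "x \<ominus> (x \<ominus> z) = z"
        using xc by algebra+
      then show "y = z" using e by simp
    qed
    have img: "(\<lambda>y. x \<ominus> y) ` (?A - {x}) = V - {\<zero>}"
    proof (intro equalityI subsetI)
      fix w assume "w \<in> (\<lambda>y. x \<ominus> y) ` (?A - {x})"
      then obtain y where y: "y \<in> ?A" "y \<noteq> x" "w = x \<ominus> y" by auto
      then obtain u v where uv: "u \<in> V" "v \<in> V" "x = u \<oplus> a" "y = v \<oplus> a"
        using x unfolding A by auto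
      then have "u \<in> carrier R" "v \<in> carrier R" using Vc by auto
      then have "w = u \<ominus> v"
        unfolding y uv using a by algebra
      then have "w \<in> V" using Vadd uv by simp
      moreover have "w \<noteq> \<zero>"
        using y xc Ac by (auto simp: subset_iff)
      ultimately show "w \<in> V - {\<zero>}" by simp
    next
      fix w assume w: "w \<in> V - {\<zero>}"
      obtain u where u: "u \<in> V" "x = u \<oplus> a" using x unfolding A by auto
      have wc: "w \<in> carrier R" "u \<in> carrier R" using w u Vc by auto
      have "x \<ominus> w = (u \<ominus> w) \<oplus> a" unfolding u using wc a by algebra
      then have mem: "x \<ominus> w \<in> ?A" unfolding A using Vadd u w by auto
      have "x \<ominus> (x \<ominus> w) = w" using xc wc by algebra
      moreover have "x \<ominus> w \<noteq> x"
      proof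
        assume "x \<ominus> w = x"
        then have "w = \<zero>"
          using \<open>x \<ominus> (x \<ominus> w) = w\<close> xc r_right_minus_eq by metis
        with w show False by simp
      qed
      ultimately show "w \<in> (\<lambda>y. x \<ominus> y) ` (?A - {x})"
        using mem by (metis Diff_iff image_eqI singletonD)
    qed
    have "?P = (\<Otimes>v\<in>(\<lambda>y. x \<ominus> y) ` (?A - {x}). v)" unfolding img ..
    also have "\<dots> = (\<Otimes>y\<in>?A - {x}. x \<ominus> y)"
      using Vc by (intro finprod_reindex inj) (auto simp: img)
    finally show ?thesis by simp
  qed
  let ?S = "\<Oplus>x\<in>?A. x [^] (card V - 1)"
  \<comment> \<open>Guards the truncated subtraction: \<open>Suc (card V - 1) = card V\<close>, so
    the exponent is the top one in \<open>divided_difference_pow\<close>.\<close>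
  have pos: "card V > 0" using Vc V(2) by (auto simp: card_gt_0_iff)
  have PU: "?P \<in> Units R" using P field_Units by simp
  have S: "?S \<in> carrier R" using Ac by (intro finsum_closed) auto
  have "\<one> = divided_difference ?A (\<lambda>x. x [^] (card V - 1))"
    using divided_difference_pow[of ?A "card V - 1"] Ac card pos by simp
  also have "\<dots> = (\<Oplus>x\<in>?A. x [^] (card V - 1) \<otimes> inv ?P)"
    unfolding divided_difference_def using Ac PU by (intro add.finprod_cong') (auto simp: denom)
  also have "\<dots> = ?S \<otimes> inv ?P"
    using Ac PU by (intro finsum_ldistr[symmetric]) auto
  finally have "?S \<otimes> inv ?P = \<one>" ..
  then have "?P = ?S \<otimes> inv ?P \<otimes> ?P" using P by simp
  also have "\<dots> = ?S" using S PU by (simp only: m_assoc Units_closed Units_inv_closed Units_l_inv r_one)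
  finally show ?thesis by simp
qed

end

section \<open>Sum-freeness on affine subspaces\<close>

theorem theorem2p3:
  fixes R :: "('a, 'b) ring_scheme" and K :: "'a set" and q n k :: nat
  assumes "primepow q" and "n > 0" and "k \<le> n"
    and "field R" and "order R = q ^ n"
    and "subfield K R" and "card K = q"
  shows "sum_free_of_order R K k (\<lambda>x. x [^]\<^bsub>R\<^esub> (q ^ k - 1))"
proof -
  interpret field R by fact
  have "q > 0" using assms(1) by (rule primepow_gt_0_nat)
  show ?thesis
    unfolding sum_free_of_order_def affine_subspace_def linear_subspace_def
  proof (intro conjI allI impI)
    fix A
    assume "\<exists>V a. (subalgebra K V R \<and> dimension k K V) \<and> a \<in> carrier R \<and> A = V +>\<^bsub>R\<^esub> a"
    then obtain V a where V: "subalgebra K V R" "dimension k K V" and a: "a \<in> carrier R"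
      and A: "A = V +>\<^bsub>R\<^esub> a" by blast
    \<comment> \<open>Infinite sets have \<open>card\<close> equal to 0, so a positive cardinality
      gives finiteness, here of \<open>K\<close> and next of \<open>V\<close>.\<close>
    have card: "card V = q ^ k"
      using card_eq_of_dimension[OF assms(6) _ V(2)] assms(7) \<open>q > 0\<close> by (simp add: card_ge_0_finite)
    then have fin: "finite V" using \<open>q > 0\<close> by (intro card_ge_0_finite) simp
    have sg: "subgroup V (add_monoid R)" using V(1) by (rule subalgebra.axioms(1))
    have "(\<Oplus>\<^bsub>R\<^esub>x\<in>A. x [^]\<^bsub>R\<^esub> (q ^ k - 1)) = (\<Otimes>\<^bsub>R\<^esub>v\<in>V - {\<zero>\<^bsub>R\<^esub>}. v)"
      using sum_pow_coset[OF sg fin a] unfolding A card .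
    \<comment> \<open>A product of nonzero field elements is nonzero; for \<open>k = 0\<close> it is
      the empty product.\<close>
    moreover have "(\<Otimes>\<^bsub>R\<^esub>v\<in>V - {\<zero>\<^bsub>R\<^esub>}. v) \<in> carrier R - {\<zero>\<^bsub>R\<^esub>}"
      using fin subgroup.subset[OF sg] by (intro finprod_nonzero) auto
    ultimately show "(\<Oplus>\<^bsub>R\<^esub>x\<in>A. x [^]\<^bsub>R\<^esub> (q ^ k - 1)) \<noteq> \<zero>\<^bsub>R\<^esub>" by simp
  qed auto
qed

end
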